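(* Let $B$ be a skew brace. Then $\lambda_f(B)$ is a left ideal of $B$. Furthermore, if $C$ is a skew brace and $\varphi:B\to C$ is a skew brace epimorphism, then $\varphi(\lambda_f(B))\subseteq\lambda_f(C)$.
   Context: A skew brace is a triple $(B,+,\circ)$ where $(B,+)$ and $(B,\circ)$ are (not necessarily abelian) groups with $a\circ(b+c)=a\circ b-a+a\circ c$ for all $a,b,c\in B$, where $-a$ is the inverse of $a$ in $(B,+)$ and $\circ$ takes precedence over $+$. Put $\lambda_a(b)=-a+a\circ b$. Define $\lambda_f(B)=\{x\in B:\{\lambda_a(x):a\in B\}\text{ is finite}\}$. A left ideal is a subgroup $L$ of $(B,+)$ with $\lambda_b(L)=L$ for all $b\in B$. A skew brace morphism is a map that is a homomorphism of both additive and multiplicative groups; an epimorphism is a surjective morphism. *)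

theory Defs
  imports "HOL-Algebra.Ring"
begin

text \<open>
  A skew brace is carried by the ring record of HOL-Algebra, used purely as a signature:
  \<open>\<oplus>\<close> is the (not necessarily abelian) additive operation \<open>+\<close> and \<open>\<otimes>\<close> is the circle
  operation \<open>\<circ>\<close>. No ring axioms are assumed.
\<close>

locale skew_brace =
  fixes B :: "('a, 'm) ring_scheme" (structure)
  assumes additive_group: "group (add_monoid B)"
    and circle_group: "group B"
    and brace_distrib: "\<lbrakk>a \<in> carrier B; b \<in> carrier B; c \<in> carrier B\<rbrakk> \<Longrightarrow>
      a \<otimes> (b \<oplus> c) = ((a \<otimes> b) \<oplus> (\<ominus> a)) \<oplus> (a \<otimes> c)"

definition lambda_map :: "('a, 'm) ring_scheme \<Rightarrow> 'a \<Rightarrow> 'a \<Rightarrow> 'a" where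
  "lambda_map B a b = (\<ominus>\<^bsub>B\<^esub> a) \<oplus>\<^bsub>B\<^esub> (a \<otimes>\<^bsub>B\<^esub> b)"

definition lambda_f :: "('a, 'm) ring_scheme \<Rightarrow> 'a set" where
  "lambda_f B = {x \<in> carrier B. finite {lambda_map B a x | a. a \<in> carrier B}}"

definition left_ideal :: "('a, 'm) ring_scheme \<Rightarrow> 'a set \<Rightarrow> bool" where
  "left_ideal B L \<longleftrightarrow>
    subgroup L (add_monoid B) \<and> (\<forall>b \<in> carrier B. lambda_map B b ` L = L)"

definition skew_brace_hom ::
    "('a, 'm) ring_scheme \<Rightarrow> ('b, 'n) ring_scheme \<Rightarrow> ('a \<Rightarrow> 'b) set" where
  "skew_brace_hom B C = hom (add_monoid B) (add_monoid C) \<inter> hom B C"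

definition skew_brace_epi ::
    "('a, 'm) ring_scheme \<Rightarrow> ('b, 'n) ring_scheme \<Rightarrow> ('a \<Rightarrow> 'b) set" where
  "skew_brace_epi B C = {\<phi> \<in> skew_brace_hom B C. \<phi> ` carrier B = carrier C}"

end

theory Submission
  imports Defs
begin

text \<open>
  The maps \<open>\<lambda>\<^sub>a\<close> form an action of the circle group on the additive group by automorphisms, and
  \<open>\<lambda>\<^sub>f(B)\<close> is the set of elements with finite orbit. Since the action is by additive maps, the orbit
  of \<open>x + y\<close> lies in the sum of the orbits of \<open>x\<close> and \<open>y\<close>, and the orbit of \<open>-x\<close> consists of
  the negatives of the orbit of \<open>x\<close>; this makes \<open>\<lambda>\<^sub>f(B)\<close> an additive subgroup. It is invariant
  because \<open>x\<close> and \<open>\<lambda>\<^sub>b(x)\<close> have the same orbit. Finally, a morphism \<open>\<phi>\<close> satisfies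
  \<open>\<phi>(\<lambda>\<^sub>a(x)) = \<lambda>\<^bsub>\<phi>(a)\<^esub>(\<phi>(x))\<close>, and surjectivity ensures that every acting element of the
  target is some \<open>\<phi>(a)\<close>, so the orbit of \<open>\<phi>(x)\<close> is the image of the orbit of \<open>x\<close>.
\<close>

context skew_brace
begin

sublocale additive: group "add_monoid B"
  rewrites "carrier (add_monoid B) = carrier B"
    and "mult (add_monoid B) = add B"
    and "one (add_monoid B) = zero B"
    and "m_inv (add_monoid B) = a_inv B"
  by (simp_all add: additive_group a_inv_def)

sublocale circle: group B
  by (rule circle_group)

abbreviation lam :: "'a \<Rightarrow> 'a \<Rightarrow> 'a" where
  "lam \<equiv> lambda_map B"

lemma lambda_closed [simp]:
  "\<lbrakk>a \<in> carrier B; x \<in> carrier B\<rbrakk> \<Longrightarrow> lam a x \<in> carrier B"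
  by (simp add: lambda_map_def)

lemma lambda_add:
  assumes "a \<in> carrier B" "x \<in> carrier B" "y \<in> carrier B"
  shows "lam a (x \<oplus> y) = lam a x \<oplus> lam a y"
  using assms by (simp add: lambda_map_def brace_distrib additive.m_assoc)

lemma lambda_group_hom:
  assumes "a \<in> carrier B"
  shows "group_hom (add_monoid B) (add_monoid B) (lam a)"
  using assms additive_group
  by (auto simp: group_hom_def group_hom_axioms_def hom_def lambda_add)

lemma lambda_zero:
  assumes "a \<in> carrier B"
  shows "lam a \<zero> = \<zero>"
  using group_hom.hom_one[OF lambda_group_hom[OF assms]] by simp

lemma lambda_minus:
  assumes "a \<in> carrier B" "x \<in> carrier B"
  shows "lam a (\<ominus> x) = \<ominus> (lam a x)"
  using group_hom.hom_inv[OF lambda_group_hom[OF assms(1)], of x] assms(2)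
  by (simp add: a_inv_def)

lemma circle_eq_add_lambda:
  assumes "a \<in> carrier B" "x \<in> carrier B"
  shows "a \<otimes> x = a \<oplus> lam a x"
  using assms by (simp add: lambda_map_def additive.m_assoc[symmetric])

text \<open>Additivity of \<open>\<lambda>\<^sub>a\<close> gives \<open>a \<circ> 0 = a + \<lambda>\<^sub>a(0) = a\<close>, so \<open>0\<close> is a right identity of the
  circle group.\<close>

lemma one_eq_zero: "\<one> = \<zero>"
  using circle_eq_add_lambda[of \<one> \<zero>] by (simp add: lambda_zero)

lemma lambda_one:
  assumes "x \<in> carrier B"
  shows "lam \<one> x = x"
  by (metis assms circle_eq_add_lambda circle.l_one circle.one_closed additive.l_one
      lambda_closed one_eq_zero)

text \<open>Both sides agree after adding \<open>a \<circ> b = a + \<lambda>\<^sub>a(b)\<close> on the left: by additivity of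
  \<open>\<lambda>\<^sub>a\<close> each becomes \<open>a \<circ> b \<circ> x\<close>.\<close>

lemma lambda_circle:
  assumes "a \<in> carrier B" "b \<in> carrier B" "x \<in> carrier B"
  shows "lam (a \<otimes> b) x = lam a (lam b x)"
proof -
  have "(a \<otimes> b) \<oplus> lam (a \<otimes> b) x = a \<otimes> (b \<otimes> x)"
    using assms by (simp add: circle_eq_add_lambda[symmetric] circle.m_assoc)
  also have "\<dots> = a \<oplus> lam a (b \<oplus> lam b x)"
    using assms by (simp add: circle_eq_add_lambda)
  also have "\<dots> = (a \<otimes> b) \<oplus> lam a (lam b x)"
    using assms by (simp add: lambda_add circle_eq_add_lambda[of a b] additive.m_assoc)
  finally show ?thesis
    using assms by simp
qed

definition lambda_orbit :: "'a \<Rightarrow> 'a set" where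
  "lambda_orbit x = {lam a x | a. a \<in> carrier B}"

lemma lambda_f_iff: "x \<in> lambda_f B \<longleftrightarrow> x \<in> carrier B \<and> finite (lambda_orbit x)"
  by (simp add: lambda_f_def lambda_orbit_def)

lemma lambda_f_subgroup: "subgroup (lambda_f B) (add_monoid B)"
proof (rule group.subgroupI[OF additive_group])
  show "lambda_f B \<subseteq> carrier (add_monoid B)"
    by (auto simp: lambda_f_iff)
  have "lambda_orbit \<zero> \<subseteq> {\<zero>}"
    by (auto simp: lambda_orbit_def lambda_zero)
  then have "\<zero> \<in> lambda_f B"
    by (simp add: lambda_f_iff finite_subset)
  then show "lambda_f B \<noteq> {}"
    by blast
next
  fix x assume x: "x \<in> lambda_f B"
  then have "lambda_orbit (\<ominus> x) \<subseteq> a_inv B ` lambda_orbit x"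
    by (auto simp: lambda_f_iff lambda_orbit_def lambda_minus)
  then show "inv\<^bsub>add_monoid B\<^esub> x \<in> lambda_f B"
    using x by (simp add: lambda_f_iff finite_subset flip: a_inv_def)
next
  fix x y assume xy: "x \<in> lambda_f B" "y \<in> lambda_f B"
  then have "lambda_orbit (x \<oplus> y) \<subseteq> (\<lambda>(u, v). u \<oplus> v) ` (lambda_orbit x \<times> lambda_orbit y)"
    by (force simp: lambda_f_iff lambda_orbit_def lambda_add)
  moreover have "finite (lambda_orbit x \<times> lambda_orbit y)"
    using xy by (simp add: lambda_f_iff)
  ultimately have "finite (lambda_orbit (x \<oplus> y))"
    by (meson finite_imageI finite_subset)
  then show "x \<otimes>\<^bsub>add_monoid B\<^esub> y \<in> lambda_f B"
    using xy by (simp add: lambda_f_iff)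
qed

lemma lambda_preserves_lambda_f:
  assumes b: "b \<in> carrier B" and x: "x \<in> lambda_f B"
  shows "lam b x \<in> lambda_f B"
proof -
  have "lambda_orbit (lam b x) \<subseteq> lambda_orbit x"
    using b x circle.m_closed
    by (fastforce simp: lambda_orbit_def lambda_f_iff simp flip: lambda_circle)
  then show ?thesis
    using b x by (simp add: lambda_f_iff finite_subset)
qed

lemma lambda_f_left_ideal: "left_ideal B (lambda_f B)"
  unfolding left_ideal_def
proof (intro conjI ballI lambda_f_subgroup equalityI subsetI)
  fix b x assume "b \<in> carrier B" "x \<in> lam b ` lambda_f B"
  then show "x \<in> lambda_f B"
    by (auto intro: lambda_preserves_lambda_f)
next
  fix b x assume b: "b \<in> carrier B" and x: "x \<in> lambda_f B"
  have "x = lam b (lam (inv b) x)"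
    using b x by (simp add: lambda_f_iff lambda_one flip: lambda_circle)
  then show "x \<in> lam b ` lambda_f B"
    using b x by (auto intro: lambda_preserves_lambda_f)
qed

end

lemma skew_brace_hom_lambda:
  assumes "skew_brace B" "skew_brace C" and \<phi>: "\<phi> \<in> skew_brace_hom B C"
    and a: "a \<in> carrier B" and x: "x \<in> carrier B"
  shows "\<phi> (lambda_map B a x) = lambda_map C (\<phi> a) (\<phi> x)"
proof -
  interpret B: skew_brace B by fact
  interpret C: skew_brace C by fact
  have "group_hom (add_monoid B) (add_monoid C) \<phi>"
    using \<phi> B.additive_group C.additive_group
    by (simp add: group_hom_def group_hom_axioms_def skew_brace_hom_def)
  then have minus: "\<phi> (\<ominus>\<^bsub>B\<^esub> a) = \<ominus>\<^bsub>C\<^esub> \<phi> a"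
    using group_hom.hom_inv[of "add_monoid B" "add_monoid C" \<phi> a] a by (simp add: a_inv_def)
  have add: "\<phi> (u \<oplus>\<^bsub>B\<^esub> v) = \<phi> u \<oplus>\<^bsub>C\<^esub> \<phi> v"
    if "u \<in> carrier B" "v \<in> carrier B" for u v
    using \<phi> that by (simp add: skew_brace_hom_def hom_def)
  have circle: "\<phi> (a \<otimes>\<^bsub>B\<^esub> x) = \<phi> a \<otimes>\<^bsub>C\<^esub> \<phi> x"
    using \<phi> a x by (simp add: skew_brace_hom_def hom_def)
  show ?thesis
    using a x by (simp add: lambda_map_def add minus circle)
qed

lemma skew_brace_epi_lambda_f:
  assumes B: "skew_brace B" and C: "skew_brace C" and \<phi>: "\<phi> \<in> skew_brace_epi B C"
  shows "\<phi> ` lambda_f B \<subseteq> lambda_f C"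
proof
  fix y assume "y \<in> \<phi> ` lambda_f B"
  then obtain x where y: "y = \<phi> x" and x: "x \<in> carrier B"
    and fin: "finite {lambda_map B a x | a. a \<in> carrier B}"
    by (auto simp: lambda_f_def)
  have hom: "\<phi> \<in> skew_brace_hom B C" and surj: "\<phi> ` carrier B = carrier C"
    using \<phi> by (auto simp: skew_brace_epi_def)
  have "{lambda_map C c y | c. c \<in> carrier C} \<subseteq> \<phi> ` {lambda_map B a x | a. a \<in> carrier B}"
    unfolding y surj[symmetric]
    by (auto simp flip: skew_brace_hom_lambda[OF B C hom _ x])
  then have "finite {lambda_map C c y | c. c \<in> carrier C}"
    using fin by (rule finite_subset[OF _ finite_imageI])
  then show "y \<in> lambda_f C"
    using surj x y by (auto simp: lambda_f_def)
qed

theorem proposition4p2: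
  fixes B :: "('a, 'm) ring_scheme"
  assumes "skew_brace B"
  shows "left_ideal B (lambda_f B) \<and>
    (\<forall>(C :: ('b, 'n) ring_scheme) \<phi>.
      skew_brace C \<longrightarrow> \<phi> \<in> skew_brace_epi B C \<longrightarrow> \<phi> ` lambda_f B \<subseteq> lambda_f C)"
  using assms skew_brace.lambda_f_left_ideal skew_brace_epi_lambda_f by blast

end
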